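(* Let $(\tilde L,\tilde\alpha,\tilde\pi,[,],D)$ be a $D$-Lie algebra and let $(E,\rho)$ be an $\tilde L$-connection. Assume the canonical quotient $(L,\alpha)$ of $\tilde L$ is a projective $A$-module. Then $(E,\rho)$ is of the form $C_f(E,\nabla)$, where $f\in Z^2(\operatorname{Der}_k(A),A)$ and $(E,\nabla)$ is an $(L,\psi)$-connection for some $\psi\in\operatorname{End}_A(E)$; that is, there are a 2-cocycle $f$, an isomorphism of $D$-Lie algebras $\tau:L(f^{\alpha})\to\tilde L$ and an $(L,\psi)$-connection $\nabla$ on $E$ such that $\rho(\tau(az+x))=a\psi+\nabla(x)$ for all $a\in A$, $x\in L$. If $\rho(D)=\operatorname{Id}_E$, one may choose $(E,\nabla)$ to be an $L$-connection.
   Context: $k$ is a commutative unital ring and $A$ a commutative unital $k$-algebra. $I$ is the kernel of the multiplication $A\otimes_k A\to A$ and $P:=A\otimes_k A/I^2$. A left $P$-module is a left $A\otimes_k A$-module annihilated by $I^2$; write $cu:=(c\otimes 1)u$, $uc:=(1\otimes c)u$ and $dc:=1\otimes c-c\otimes 1$, so $dc\cdot u=uc-cu$. $\operatorname{Der}_k(A)$ is a $P$-module with $xc:=cx$. An $A/k$-Lie-Rinehart algebra $(L,\alpha)$ is a $k$-Lie algebra and left $A$-module $L$ with an $A$-linear map of $k$-Lie algebras $\alpha:L\to\operatorname{Der}_k(A)$ such that $[x,ay]=a[x,y]+\alpha(x)(a)y$. $Z^2(L,A)$ is the group of 2-cocycles of the Lie-Rinehart complex $C^p(L,A)=\operatorname{Hom}_A(\wedge^p_A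 L,A)$; $\operatorname{Der}_k(A)$ is a Lie-Rinehart algebra with identity anchor. For $f\in Z^2(\operatorname{Der}_k(A),A)$ let $f^{\alpha}(x,y):=f(\alpha(x),\alpha(y))\in Z^2(L,A)$. $D^1(A,f):=A\oplus\operatorname{Der}_k(A)$ with $[(a,x),(b,y)]:=(x(b)-y(a)+f(x,y),[x,y])$, $c(a,x):=(ca,cx)$, $(a,x)c:=(ac+x(c),cx)$ and $\pi(a,x):=x$; it is a $k$-Lie algebra and left $P$-module. A $D$-Lie algebra (relative to a 2-cocycle $f$) is a 5-tuple $(\tilde L,\tilde\alpha,\tilde\pi,[,],D)$ where $\tilde L$ is a $k$-Lie algebra and left $P$-module, $\tilde\alpha:\tilde L\to D^1(A,f)$ and $\tilde\pi:\tilde L\to\operatorname{Der}_k(A)$ are maps of $P$-modules and $k$-Lie algebras with $\tilde\pi=\pi\circ\tilde\alpha$, $[u,av]=a[u,v]+\tilde\pi(u)(a)v$, $da\cdot u=\tilde\pi(u)(a)D$ for all $u,v\in\tilde L$, $a\in A$, and $D\in\tilde L$ is a central element with $\tilde\pi(D)=0$. A map of $D$-Lie algebras $\phi:\tilde L\to\tilde L'$ is a map of left $P$-modules and $k$-Lie algebras with $\phi(D)=D'$ and $\tilde\pi=\tilde\pi'\circ\phi$. The canonical quotient of $\tilde L$ is $L:=\tilde L/J$, $J:=\{aD:a\in A\}$, with anchor $\alpha$ induced by $\tilde\pi$; it is an $A/k$-Lie-Rinehart algebra. $L(f^{\alpha}):=Az\oplus L$ is the $D$-Lie algebra with $[az+x,bz+y]:=(\alpha(x)(b)-\alpha(y)(a)+f^{\alpha}(x,y))z+[x,y]$,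 $c(az+x):=caz+cx$, $(az+x)c:=(ac+\alpha(x)(c))z+cx$, $\tilde\alpha(az+x):=(a,\alpha(x))\in D^1(A,f)$, $\tilde\pi(az+x):=\alpha(x)$ and central element $z$. For a left $A$-module $E$, $\operatorname{Diff}^1(E)$ is the set of $\partial\in\operatorname{End}_k(E)$ with $[[\partial,a],b]=0$ for all $a,b\in A$; it is a left $P$-module by $(a\otimes b\cdot\partial)(e):=a\partial(be)$. An $\tilde L$-connection is a pair $(E,\rho)$ with $\rho:\tilde L\to\operatorname{Diff}^1(E)$ a map of left $P$-modules. For $\psi\in\operatorname{End}_A(E)$, an $(L,\psi)$-connection on $E$ is an $A$-linear map $\nabla:L\to\operatorname{End}_k(E)$ with $\nabla(x)(ae)=a\nabla(x)(e)+\alpha(x)(a)\psi(e)$; an $L$-connection is the case $\psi=\operatorname{Id}_E$. $C_f(E,\nabla)$ is the $L(f^{\alpha})$-connection $(E,\rho_\nabla)$ with $\rho_\nabla(az+x):=a\psi+\nabla(x)$.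
   Formalization: The formal theorem also assumes α̃(D) = (1,0) in D^1(A,f); without it the claim fails (k = A = Z, L̃ = 0, E = 0: then L(f^α) = Az is nonzero). With it, projectivity of L is not needed. *)

theory Defs
  imports "HOL-Algebra.Module" "HOL-Algebra.QuotRing"
begin

text \<open>
  Throughout, \<open>k\<close> and \<open>A\<close> are records with \<^term>\<open>algebra k A\<close>, i.e. \<open>k\<close> is a commutative ring and
  \<open>A\<close> a commutative \<open>k\<close>-algebra (both possibly zero). Every \<open>A\<close>-module is a \<open>k\<close>-module through the
  structure map \<open>k \<rightarrow> A\<close> below. Record fields \<^const>\<open>mult\<close> and \<^const>\<open>one\<close> of a module are unused and
  left \<^const>\<open>undefined\<close>. Sets of maps that serve as carriers consist of extensional functions.
\<close>

definition str_map :: "('k, 'a, 's) module_scheme \<Rightarrow> 'k \<Rightarrow> 'a" where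
  "str_map A \<kappa> = \<kappa> \<odot>\<^bsub>A\<^esub> \<one>\<^bsub>A\<^esub>"

definition mod_hom ::
    "('a, 'r) ring_scheme \<Rightarrow> ('a, 'm, 's) module_scheme \<Rightarrow> ('a, 'n, 't) module_scheme \<Rightarrow> ('m \<Rightarrow> 'n) set"
  where "mod_hom A M N = {h \<in> carrier M \<rightarrow> carrier N.
    (\<forall>x\<in>carrier M. \<forall>y\<in>carrier M. h (x \<oplus>\<^bsub>M\<^esub> y) = h x \<oplus>\<^bsub>N\<^esub> h y) \<and>
    (\<forall>a\<in>carrier A. \<forall>x\<in>carrier M. h (a \<odot>\<^bsub>M\<^esub> x) = a \<odot>\<^bsub>N\<^esub> h x)}"

text \<open>
  Projectivity is the lifting property against surjections \<open>g : N \<rightarrow> N'\<close>. Restricting the types of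
  the test modules loses nothing: \<open>N' = M\<close> and \<open>N\<close> = the free module on the set \<open>M\<close> (finitely supported
  functions \<open>M \<rightarrow> A\<close>) are available, so the restricted property already makes \<open>M\<close> a direct summand of
  a free module.
\<close>

definition projective_module :: "('a, 'r) ring_scheme \<Rightarrow> ('a, 'm, 's) module_scheme \<Rightarrow> bool" where
  "projective_module A M \<longleftrightarrow> module A M \<and>
    (\<forall>(N :: ('a, 'm \<Rightarrow> 'a) module) (N' :: ('a, 'm) module) g h.
      module A N \<and> module A N' \<and> g \<in> mod_hom A N N' \<and> g ` carrier N = carrier N' \<and> h \<in> mod_hom A M N' \<longrightarrow>
      (\<exists>l\<in>mod_hom A M N. \<forall>x\<in>carrier M. g (l x) = h x))"


section \<open>Left modules over \<open>P = A \<otimes>\<^sub>k A / I\<^sup>2\<close>\<close>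

text \<open>
  A left \<open>A \<otimes>\<^sub>k A\<close>-module is given by its two commuting \<open>A\<close>-actions \<open>c u = (c \<otimes> 1) u\<close> and
  \<open>u c = (1 \<otimes> c) u\<close>, which agree on the image of \<open>k\<close>. An element of \<open>A \<otimes>\<^sub>k A\<close> is represented by
  a list of pairs, read as the sum of the tensors \<open>a \<otimes> b\<close>; the lists in \<open>mult_kernel\<close> represent
  the elements of \<open>I\<close>, and \<open>I\<^sup>2\<close> is additively generated by products of two of these.
\<close>

record ('a, 'm) bimodule = "('a, 'm) module" +
  ract :: "'m \<Rightarrow> 'a \<Rightarrow> 'm" (infixl "\<oslash>\<index>" 70)

definition tensor_act :: "('a, 'm, 's) bimodule_scheme \<Rightarrow> ('a \<times> 'a) list \<Rightarrow> 'm \<Rightarrow> 'm" where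
  "tensor_act M t u = foldr (\<lambda>(a, b) v. (a \<odot>\<^bsub>M\<^esub> (u \<oslash>\<^bsub>M\<^esub> b)) \<oplus>\<^bsub>M\<^esub> v) t \<zero>\<^bsub>M\<^esub>"

definition tensor_mult :: "('a, 'r) ring_scheme \<Rightarrow> ('a \<times> 'a) list \<Rightarrow> 'a" where
  "tensor_mult A t = foldr (\<lambda>(a, b) c. (a \<otimes>\<^bsub>A\<^esub> b) \<oplus>\<^bsub>A\<^esub> c) t \<zero>\<^bsub>A\<^esub>"

definition mult_kernel :: "('a, 'r) ring_scheme \<Rightarrow> ('a \<times> 'a) list set" where
  "mult_kernel A = {t. set t \<subseteq> carrier A \<times> carrier A \<and> tensor_mult A t = \<zero>\<^bsub>A\<^esub>}"

locale P_module = algebra k A + M: module A M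
  for k :: "('k, 'r) ring_scheme" and A :: "('k, 'a, 's) module_scheme"
    and M :: "('a, 'm, 't) bimodule_scheme" +
  assumes ract_closed: "\<lbrakk>u \<in> carrier M; a \<in> carrier A\<rbrakk> \<Longrightarrow> u \<oslash>\<^bsub>M\<^esub> a \<in> carrier M"
    and ract_l_distr: "\<lbrakk>u \<in> carrier M; v \<in> carrier M; a \<in> carrier A\<rbrakk> \<Longrightarrow>
      (u \<oplus>\<^bsub>M\<^esub> v) \<oslash>\<^bsub>M\<^esub> a = u \<oslash>\<^bsub>M\<^esub> a \<oplus>\<^bsub>M\<^esub> v \<oslash>\<^bsub>M\<^esub> a"
    and ract_r_distr: "\<lbrakk>u \<in> carrier M; a \<in> carrier A; b \<in> carrier A\<rbrakk> \<Longrightarrow>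
      u \<oslash>\<^bsub>M\<^esub> (a \<oplus>\<^bsub>A\<^esub> b) = u \<oslash>\<^bsub>M\<^esub> a \<oplus>\<^bsub>M\<^esub> u \<oslash>\<^bsub>M\<^esub> b"
    and ract_assoc: "\<lbrakk>u \<in> carrier M; a \<in> carrier A; b \<in> carrier A\<rbrakk> \<Longrightarrow>
      u \<oslash>\<^bsub>M\<^esub> (a \<otimes>\<^bsub>A\<^esub> b) = (u \<oslash>\<^bsub>M\<^esub> a) \<oslash>\<^bsub>M\<^esub> b"
    and ract_one: "u \<in> carrier M \<Longrightarrow> u \<oslash>\<^bsub>M\<^esub> \<one>\<^bsub>A\<^esub> = u"
    and smult_ract: "\<lbrakk>u \<in> carrier M; a \<in> carrier A; b \<in> carrier A\<rbrakk> \<Longrightarrow>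
      (a \<odot>\<^bsub>M\<^esub> u) \<oslash>\<^bsub>M\<^esub> b = a \<odot>\<^bsub>M\<^esub> (u \<oslash>\<^bsub>M\<^esub> b)"
    and k_central: "\<lbrakk>u \<in> carrier M; \<kappa> \<in> carrier k\<rbrakk> \<Longrightarrow>
      u \<oslash>\<^bsub>M\<^esub> str_map A \<kappa> = str_map A \<kappa> \<odot>\<^bsub>M\<^esub> u"
    and I_square: "\<lbrakk>u \<in> carrier M; s \<in> mult_kernel A; t \<in> mult_kernel A\<rbrakk> \<Longrightarrow>
      tensor_act M s (tensor_act M t u) = \<zero>\<^bsub>M\<^esub>"

definition P_hom ::
    "('a, 'r) ring_scheme \<Rightarrow> ('a, 'm, 's) bimodule_scheme \<Rightarrow> ('a, 'n, 't) bimodule_scheme \<Rightarrow> ('m \<Rightarrow> 'n) set"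
  where "P_hom A M N = {h \<in> mod_hom A M N.
    \<forall>u\<in>carrier M. \<forall>a\<in>carrier A. h (u \<oslash>\<^bsub>M\<^esub> a) = h u \<oslash>\<^bsub>N\<^esub> a}"


section \<open>Lie algebras, derivations and cocycles\<close>

locale lie_algebra = algebra k A + M: module A M
  for k :: "('k, 'r) ring_scheme" and A :: "('k, 'a, 's) module_scheme"
    and M :: "('a, 'm, 't) module_scheme" and br :: "'m \<Rightarrow> 'm \<Rightarrow> 'm" +
  assumes br_closed: "\<lbrakk>u \<in> carrier M; v \<in> carrier M\<rbrakk> \<Longrightarrow> br u v \<in> carrier M"
    and br_add_l: "\<lbrakk>u \<in> carrier M; v \<in> carrier M; w \<in> carrier M\<rbrakk> \<Longrightarrow>
      br (u \<oplus>\<^bsub>M\<^esub> v) w = br u w \<oplus>\<^bsub>M\<^esub> br v w"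
    and br_add_r: "\<lbrakk>u \<in> carrier M; v \<in> carrier M; w \<in> carrier M\<rbrakk> \<Longrightarrow>
      br u (v \<oplus>\<^bsub>M\<^esub> w) = br u v \<oplus>\<^bsub>M\<^esub> br u w"
    and br_k_l: "\<lbrakk>\<kappa> \<in> carrier k; u \<in> carrier M; v \<in> carrier M\<rbrakk> \<Longrightarrow>
      br (str_map A \<kappa> \<odot>\<^bsub>M\<^esub> u) v = str_map A \<kappa> \<odot>\<^bsub>M\<^esub> br u v"
    and br_k_r: "\<lbrakk>\<kappa> \<in> carrier k; u \<in> carrier M; v \<in> carrier M\<rbrakk> \<Longrightarrow>
      br u (str_map A \<kappa> \<odot>\<^bsub>M\<^esub> v) = str_map A \<kappa> \<odot>\<^bsub>M\<^esub> br u v"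
    and br_alt: "u \<in> carrier M \<Longrightarrow> br u u = \<zero>\<^bsub>M\<^esub>"
    and jacobi: "\<lbrakk>u \<in> carrier M; v \<in> carrier M; w \<in> carrier M\<rbrakk> \<Longrightarrow>
      br u (br v w) \<oplus>\<^bsub>M\<^esub> br v (br w u) \<oplus>\<^bsub>M\<^esub> br w (br u v) = \<zero>\<^bsub>M\<^esub>"

record ('a, 'm) lie_bimodule = "('a, 'm) bimodule" +
  bracket :: "'m \<Rightarrow> 'm \<Rightarrow> 'm"

definition P_lie_hom ::
    "('a, 'r) ring_scheme \<Rightarrow> ('a, 'm, 's) lie_bimodule_scheme \<Rightarrow> ('a, 'n, 't) lie_bimodule_scheme
      \<Rightarrow> ('m \<Rightarrow> 'n) set"
  where "P_lie_hom A M N = {h \<in> P_hom A M N.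
    \<forall>u\<in>carrier M. \<forall>v\<in>carrier M. h (bracket M u v) = bracket N (h u) (h v)}"

definition derivations :: "('k, 'r) ring_scheme \<Rightarrow> ('k, 'a, 's) module_scheme \<Rightarrow> ('a \<Rightarrow> 'a) set" where
  "derivations k A = {\<delta> \<in> carrier A \<rightarrow>\<^sub>E carrier A.
    (\<forall>a\<in>carrier A. \<forall>b\<in>carrier A. \<delta> (a \<oplus>\<^bsub>A\<^esub> b) = \<delta> a \<oplus>\<^bsub>A\<^esub> \<delta> b) \<and>
    (\<forall>\<kappa>\<in>carrier k. \<forall>a\<in>carrier A. \<delta> (\<kappa> \<odot>\<^bsub>A\<^esub> a) = \<kappa> \<odot>\<^bsub>A\<^esub> \<delta> a) \<and>
    (\<forall>a\<in>carrier A. \<forall>b\<in>carrier A. \<delta> (a \<otimes>\<^bsub>A\<^esub> b) = \<delta> a \<otimes>\<^bsub>A\<^esub> b \<oplus>\<^bsub>A\<^esub> a \<otimes>\<^bsub>A\<^esub> \<delta> b)}"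

definition Der ::
    "('k, 'r) ring_scheme \<Rightarrow> ('k, 'a, 's) module_scheme \<Rightarrow> ('a, 'a \<Rightarrow> 'a) lie_bimodule" where
  "Der k A = \<lparr>carrier = derivations k A, mult = undefined, one = undefined,
     zero = (\<lambda>a\<in>carrier A. \<zero>\<^bsub>A\<^esub>),
     add = (\<lambda>x y. \<lambda>a\<in>carrier A. x a \<oplus>\<^bsub>A\<^esub> y a),
     smult = (\<lambda>c x. \<lambda>a\<in>carrier A. c \<otimes>\<^bsub>A\<^esub> x a),
     ract = (\<lambda>x c. \<lambda>a\<in>carrier A. c \<otimes>\<^bsub>A\<^esub> x a),
     bracket = (\<lambda>x y. \<lambda>a\<in>carrier A. x (y a) \<ominus>\<^bsub>A\<^esub> y (x a))\<rparr>"

record ('a, 'l) lie_rinehart = "('a, 'l) module" +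
  lr_bracket :: "'l \<Rightarrow> 'l \<Rightarrow> 'l"
  anchor :: "'l \<Rightarrow> 'a \<Rightarrow> 'a"

definition Der_LR ::
    "('k, 'r) ring_scheme \<Rightarrow> ('k, 'a, 's) module_scheme \<Rightarrow> ('a, 'a \<Rightarrow> 'a) lie_rinehart" where
  "Der_LR k A = \<lparr>carrier = derivations k A, mult = undefined, one = undefined,
     zero = \<zero>\<^bsub>Der k A\<^esub>, add = add (Der k A), smult = smult (Der k A),
     lr_bracket = bracket (Der k A), anchor = (\<lambda>x. x)\<rparr>"

text \<open>
  Elements of \<open>Hom\<^sub>A(\<wedge>\<^sup>2 L, A)\<close> are alternating \<open>A\<close>-bilinear maps; the last condition is
  \<open>(d f)(x, y, z) = 0\<close> for the Lie-Rinehart differential, with its negative terms on the right.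
\<close>

definition cocycles2 ::
    "('a, 'r) ring_scheme \<Rightarrow> ('a, 'l, 's) lie_rinehart_scheme \<Rightarrow> ('l \<Rightarrow> 'l \<Rightarrow> 'a) set" where
  "cocycles2 A L = {f.
    (\<forall>x\<in>carrier L. \<forall>y\<in>carrier L. f x y \<in> carrier A) \<and>
    (\<forall>x\<in>carrier L. \<forall>y\<in>carrier L. \<forall>z\<in>carrier L.
      f (x \<oplus>\<^bsub>L\<^esub> y) z = f x z \<oplus>\<^bsub>A\<^esub> f y z \<and> f x (y \<oplus>\<^bsub>L\<^esub> z) = f x y \<oplus>\<^bsub>A\<^esub> f x z) \<and>
    (\<forall>a\<in>carrier A. \<forall>x\<in>carrier L. \<forall>y\<in>carrier L.
      f (a \<odot>\<^bsub>L\<^esub> x) y = a \<otimes>\<^bsub>A\<^esub> f x y \<and> f x (a \<odot>\<^bsub>L\<^esub> y) = a \<otimes>\<^bsub>A\<^esub> f x y) \<and>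
    (\<forall>x\<in>carrier L. f x x = \<zero>\<^bsub>A\<^esub>) \<and>
    (\<forall>x\<in>carrier L. \<forall>y\<in>carrier L. \<forall>z\<in>carrier L.
      anchor L x (f y z) \<oplus>\<^bsub>A\<^esub> anchor L z (f x y) \<oplus>\<^bsub>A\<^esub> f (lr_bracket L x z) y =
      anchor L y (f x z) \<oplus>\<^bsub>A\<^esub> f (lr_bracket L x y) z \<oplus>\<^bsub>A\<^esub> f (lr_bracket L y z) x)}"


section \<open>\<open>D\<close>-Lie algebras\<close>

definition D1 ::
    "('k, 'r) ring_scheme \<Rightarrow> ('k, 'a, 's) module_scheme \<Rightarrow> (('a \<Rightarrow> 'a) \<Rightarrow> ('a \<Rightarrow> 'a) \<Rightarrow> 'a)
      \<Rightarrow> ('a, 'a \<times> ('a \<Rightarrow> 'a)) lie_bimodule" where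
  "D1 k A f = \<lparr>carrier = carrier A \<times> derivations k A, mult = undefined, one = undefined,
     zero = (\<zero>\<^bsub>A\<^esub>, \<zero>\<^bsub>Der k A\<^esub>),
     add = (\<lambda>(a, x) (b, y). (a \<oplus>\<^bsub>A\<^esub> b, x \<oplus>\<^bsub>Der k A\<^esub> y)),
     smult = (\<lambda>c (a, x). (c \<otimes>\<^bsub>A\<^esub> a, c \<odot>\<^bsub>Der k A\<^esub> x)),
     ract = (\<lambda>(a, x) c. (a \<otimes>\<^bsub>A\<^esub> c \<oplus>\<^bsub>A\<^esub> x c, c \<odot>\<^bsub>Der k A\<^esub> x)),
     bracket = (\<lambda>(a, x) (b, y). ((x b \<ominus>\<^bsub>A\<^esub> y a) \<oplus>\<^bsub>A\<^esub> f x y, bracket (Der k A) x y))\<rparr>"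

record ('a, 'l) dlie = "('a, 'l) lie_bimodule" +
  to_D1 :: "'l \<Rightarrow> 'a \<times> ('a \<Rightarrow> 'a)"
  to_Der :: "'l \<Rightarrow> 'a \<Rightarrow> 'a"
  cent :: 'l

text \<open>
  The axioms do not relate \<open>to_D1 M (cent M)\<close> to the central element \<open>(1, 0)\<close> of \<^const>\<open>D1\<close>: the zero
  module, with \<open>cent M = 0\<close>, is an instance. Statements that need \<open>A D\<close> to be free of rank one
  must assume this separately.
\<close>

locale dlie_algebra = P_module k A M + lie_algebra k A M "bracket M"
  for k :: "('k, 'r) ring_scheme" and A :: "('k, 'a, 's) module_scheme"
    and f :: "('a \<Rightarrow> 'a) \<Rightarrow> ('a \<Rightarrow> 'a) \<Rightarrow> 'a" and M :: "('a, 'l, 't) dlie_scheme" +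
  assumes cocycle: "f \<in> cocycles2 A (Der_LR k A)"
    and to_D1_hom: "to_D1 M \<in> P_lie_hom A M (D1 k A f)"
    and to_Der_hom: "to_Der M \<in> P_lie_hom A M (Der k A)"
    and to_Der_eq: "u \<in> carrier M \<Longrightarrow> to_Der M u = snd (to_D1 M u)"
    and leibniz: "\<lbrakk>u \<in> carrier M; v \<in> carrier M; a \<in> carrier A\<rbrakk> \<Longrightarrow>
      bracket M u (a \<odot>\<^bsub>M\<^esub> v) = a \<odot>\<^bsub>M\<^esub> bracket M u v \<oplus>\<^bsub>M\<^esub> to_Der M u a \<odot>\<^bsub>M\<^esub> v"
    and d_act: "\<lbrakk>u \<in> carrier M; a \<in> carrier A\<rbrakk> \<Longrightarrow>
      u \<oslash>\<^bsub>M\<^esub> a \<ominus>\<^bsub>M\<^esub> a \<odot>\<^bsub>M\<^esub> u = to_Der M u a \<odot>\<^bsub>M\<^esub> cent M"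
    and cent_closed: "cent M \<in> carrier M"
    and cent_central: "u \<in> carrier M \<Longrightarrow> bracket M (cent M) u = \<zero>\<^bsub>M\<^esub>"
    and to_Der_cent: "to_Der M (cent M) = \<zero>\<^bsub>Der k A\<^esub>"

definition dlie_hom ::
    "('a, 'r) ring_scheme \<Rightarrow> ('a, 'l, 's) dlie_scheme \<Rightarrow> ('a, 'm, 't) dlie_scheme \<Rightarrow> ('l \<Rightarrow> 'm) set" where
  "dlie_hom A M N = {h \<in> P_lie_hom A M N.
    h (cent M) = cent N \<and> (\<forall>u\<in>carrier M. to_Der M u = to_Der N (h u))}"

definition dlie_iso ::
    "('a, 'r) ring_scheme \<Rightarrow> ('a, 'l, 's) dlie_scheme \<Rightarrow> ('a, 'm, 't) dlie_scheme \<Rightarrow> ('l \<Rightarrow> 'm) set" where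
  "dlie_iso A M N = {h \<in> dlie_hom A M N. bij_betw h (carrier M) (carrier N)}"

definition cent_ideal :: "('a, 'r) ring_scheme \<Rightarrow> ('a, 'l, 's) dlie_scheme \<Rightarrow> 'l set" where
  "cent_ideal A M = {a \<odot>\<^bsub>M\<^esub> cent M |a. a \<in> carrier A}"

text \<open>
  The canonical quotient; as for \<^const>\<open>FactRing\<close>, operations on cosets are unions over representatives.
\<close>

definition canonical_quotient ::
    "('a, 'r) ring_scheme \<Rightarrow> ('a, 'l, 's) dlie_scheme \<Rightarrow> ('a, 'l set) lie_rinehart" where
  "canonical_quotient A M = (let J = cent_ideal A M in
    \<lparr>carrier = a_rcosets\<^bsub>M\<^esub> J, mult = undefined, one = undefined,
     zero = J, add = set_add M,
     smult = (\<lambda>a X. \<Union>u\<in>X. J +>\<^bsub>M\<^esub> (a \<odot>\<^bsub>M\<^esub> u)),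
     lr_bracket = (\<lambda>X Y. \<Union>u\<in>X. \<Union>v\<in>Y. J +>\<^bsub>M\<^esub> bracket M u v),
     anchor = (\<lambda>X. the_elem (to_Der M ` X))\<rparr>)"

definition pullback ::
    "('a, 'l, 's) lie_rinehart_scheme \<Rightarrow> (('a \<Rightarrow> 'a) \<Rightarrow> ('a \<Rightarrow> 'a) \<Rightarrow> 'a) \<Rightarrow> 'l \<Rightarrow> 'l \<Rightarrow> 'a" where
  "pullback L f = (\<lambda>x y. f (anchor L x) (anchor L y))"

text \<open>\<open>L(f\<^sup>\<alpha>) = A z \<oplus> L\<close>; the pair \<open>(a, x)\<close> stands for \<open>a z + x\<close>.\<close>

definition L_ext ::
    "('a, 'r) ring_scheme \<Rightarrow> ('a, 'l, 's) lie_rinehart_scheme \<Rightarrow> (('a \<Rightarrow> 'a) \<Rightarrow> ('a \<Rightarrow> 'a) \<Rightarrow> 'a)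
      \<Rightarrow> ('a, 'a \<times> 'l) dlie" where
  "L_ext A L f = \<lparr>carrier = carrier A \<times> carrier L, mult = undefined, one = undefined,
     zero = (\<zero>\<^bsub>A\<^esub>, \<zero>\<^bsub>L\<^esub>),
     add = (\<lambda>(a, x) (b, y). (a \<oplus>\<^bsub>A\<^esub> b, x \<oplus>\<^bsub>L\<^esub> y)),
     smult = (\<lambda>c (a, x). (c \<otimes>\<^bsub>A\<^esub> a, c \<odot>\<^bsub>L\<^esub> x)),
     ract = (\<lambda>(a, x) c. (a \<otimes>\<^bsub>A\<^esub> c \<oplus>\<^bsub>A\<^esub> anchor L x c, c \<odot>\<^bsub>L\<^esub> x)),
     bracket = (\<lambda>(a, x) (b, y).
       ((anchor L x b \<ominus>\<^bsub>A\<^esub> anchor L y a) \<oplus>\<^bsub>A\<^esub> pullback L f x y, lr_bracket L x y)),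
     to_D1 = (\<lambda>(a, x). (a, anchor L x)),
     to_Der = (\<lambda>(a, x). anchor L x),
     cent = (\<one>\<^bsub>A\<^esub>, \<zero>\<^bsub>L\<^esub>)\<rparr>"


section \<open>Connections\<close>

definition End_k ::
    "('k, 'r) ring_scheme \<Rightarrow> ('k, 'a, 's) module_scheme \<Rightarrow> ('a, 'e, 't) module_scheme
      \<Rightarrow> ('a, 'e \<Rightarrow> 'e) bimodule" where
  "End_k k A E = \<lparr>carrier = {\<phi> \<in> carrier E \<rightarrow>\<^sub>E carrier E.
       (\<forall>u\<in>carrier E. \<forall>v\<in>carrier E. \<phi> (u \<oplus>\<^bsub>E\<^esub> v) = \<phi> u \<oplus>\<^bsub>E\<^esub> \<phi> v) \<and>
       (\<forall>\<kappa>\<in>carrier k. \<forall>u\<in>carrier E. \<phi> (str_map A \<kappa> \<odot>\<^bsub>E\<^esub> u) = str_map A \<kappa> \<odot>\<^bsub>E\<^esub> \<phi> u)},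
     mult = undefined, one = undefined,
     zero = (\<lambda>e\<in>carrier E. \<zero>\<^bsub>E\<^esub>),
     add = (\<lambda>\<phi> \<chi>. \<lambda>e\<in>carrier E. \<phi> e \<oplus>\<^bsub>E\<^esub> \<chi> e),
     smult = (\<lambda>a \<phi>. \<lambda>e\<in>carrier E. a \<odot>\<^bsub>E\<^esub> \<phi> e),
     ract = (\<lambda>\<phi> b. \<lambda>e\<in>carrier E. \<phi> (b \<odot>\<^bsub>E\<^esub> e))\<rparr>"

definition commutator :: "('a, 'e, 't) module_scheme \<Rightarrow> ('e \<Rightarrow> 'e) \<Rightarrow> 'a \<Rightarrow> 'e \<Rightarrow> 'e" where
  "commutator E \<phi> a = (\<lambda>e\<in>carrier E. \<phi> (a \<odot>\<^bsub>E\<^esub> e) \<ominus>\<^bsub>E\<^esub> a \<odot>\<^bsub>E\<^esub> \<phi> e)"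

definition Diff1 ::
    "('k, 'r) ring_scheme \<Rightarrow> ('k, 'a, 's) module_scheme \<Rightarrow> ('a, 'e, 't) module_scheme
      \<Rightarrow> ('a, 'e \<Rightarrow> 'e) bimodule" where
  "Diff1 k A E = (End_k k A E)\<lparr>carrier := {\<phi> \<in> carrier (End_k k A E).
     \<forall>a\<in>carrier A. \<forall>b\<in>carrier A. commutator E (commutator E \<phi> a) b = \<zero>\<^bsub>End_k k A E\<^esub>}\<rparr>"

definition dlie_connection ::
    "('k, 'r) ring_scheme \<Rightarrow> ('k, 'a, 's) module_scheme \<Rightarrow> ('a, 'l, 'u) dlie_scheme
      \<Rightarrow> ('a, 'e, 't) module_scheme \<Rightarrow> ('l \<Rightarrow> 'e \<Rightarrow> 'e) \<Rightarrow> bool" where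
  "dlie_connection k A M E \<rho> \<longleftrightarrow> module A E \<and> \<rho> \<in> P_hom A M (Diff1 k A E)"

definition End_A ::
    "('a, 'r) ring_scheme \<Rightarrow> ('a, 'e, 't) module_scheme \<Rightarrow> ('e \<Rightarrow> 'e) set" where
  "End_A A E = mod_hom A E E \<inter> extensional (carrier E)"

definition psi_connection ::
    "('k, 'r) ring_scheme \<Rightarrow> ('k, 'a, 's) module_scheme \<Rightarrow> ('a, 'l, 'u) lie_rinehart_scheme
      \<Rightarrow> ('a, 'e, 't) module_scheme \<Rightarrow> ('e \<Rightarrow> 'e) \<Rightarrow> ('l \<Rightarrow> 'e \<Rightarrow> 'e) \<Rightarrow> bool" where
  "psi_connection k A L E \<psi> nabla \<longleftrightarrow> nabla \<in> mod_hom A L (End_k k A E) \<and>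
    (\<forall>x\<in>carrier L. \<forall>a\<in>carrier A. \<forall>e\<in>carrier E.
      nabla x (a \<odot>\<^bsub>E\<^esub> e) = a \<odot>\<^bsub>E\<^esub> nabla x e \<oplus>\<^bsub>E\<^esub> anchor L x a \<odot>\<^bsub>E\<^esub> \<psi> e)"

definition id_on :: "('a, 'e, 't) module_scheme \<Rightarrow> 'e \<Rightarrow> 'e" where
  "id_on E = (\<lambda>e\<in>carrier E. e)"

definition L_connection ::
    "('k, 'r) ring_scheme \<Rightarrow> ('k, 'a, 's) module_scheme \<Rightarrow> ('a, 'l, 'u) lie_rinehart_scheme
      \<Rightarrow> ('a, 'e, 't) module_scheme \<Rightarrow> ('l \<Rightarrow> 'e \<Rightarrow> 'e) \<Rightarrow> bool" where
  "L_connection k A L E nabla \<longleftrightarrow> psi_connection k A L E (id_on E) nabla"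

text \<open>\<open>\<rho>\<^sub>\<nabla>(a z + x) = a \<psi> + \<nabla>(x)\<close>, the structure map of \<open>C\<^sub>f(E, \<nabla>)\<close>.\<close>

definition C_conn ::
    "('k, 'r) ring_scheme \<Rightarrow> ('k, 'a, 's) module_scheme \<Rightarrow> ('a, 'e, 't) module_scheme
      \<Rightarrow> ('e \<Rightarrow> 'e) \<Rightarrow> ('l \<Rightarrow> 'e \<Rightarrow> 'e) \<Rightarrow> 'a \<times> 'l \<Rightarrow> 'e \<Rightarrow> 'e" where
  "C_conn k A E \<psi> nabla = (\<lambda>(a, x). a \<odot>\<^bsub>End_k k A E\<^esub> \<psi> \<oplus>\<^bsub>End_k k A E\<^esub> nabla x)"

end

theory Submission
  imports Defs
begin

text \<open>
  Since \<open>\<alpha>~(D) = (1, 0)\<close>, the first component \<open>\<lambda>\<close> of \<open>\<alpha>~\<close> is an \<open>A\<close>-linear retraction of \<open>a \<mapsto> a D\<close>.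
  Hence \<open>u \<mapsto> u - \<lambda>(u) D\<close> descends to an \<open>A\<close>-linear section \<open>s\<close> of the canonical quotient, and
  \<open>u \<mapsto> (\<lambda>(u), u + J)\<close> is an isomorphism onto \<open>L(f\<^sup>\<alpha>)\<close> for the given cocycle, with inverse
  \<open>a z + x \<mapsto> a D + s(x)\<close>. Then \<open>\<psi> = \<rho>(D)\<close> and \<open>\<nabla> = \<rho> \<circ> s\<close>. The right action gives the Leibniz rule:
  \<open>\<rho>(u)(a e) = \<rho>(u a)(e)\<close> and \<open>u a = a u + \<pi>~(u)(a) D\<close>.
\<close>

context dlie_algebra
begin

section \<open>The anchor, the coefficient of D and horizontal parts\<close>

definition cent_coeff :: "'l \<Rightarrow> 'a" where
  "cent_coeff u = fst (to_D1 M u)"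

definition horizontal :: "'l \<Rightarrow> 'l" where
  "horizontal u = u \<ominus>\<^bsub>M\<^esub> cent_coeff u \<odot>\<^bsub>M\<^esub> cent M"

abbreviation coset :: "'l \<Rightarrow> 'l set" where
  "coset u \<equiv> cent_ideal A M +>\<^bsub>M\<^esub> u"

abbreviation L :: "('a, 'l set) lie_rinehart" where
  "L \<equiv> canonical_quotient A M"

lemma to_Der_in: "u \<in> carrier M \<Longrightarrow> to_Der M u \<in> derivations k A"
  using to_Der_hom by (auto simp: P_lie_hom_def P_hom_def mod_hom_def Der_def)

lemma to_Der_closed [simp]: "\<lbrakk>u \<in> carrier M; a \<in> carrier A\<rbrakk> \<Longrightarrow> to_Der M u a \<in> carrier A"
  using to_Der_in by (fastforce simp: derivations_def)

lemma to_Der_ext: "u \<in> carrier M \<Longrightarrow> to_Der M u \<in> extensional (carrier A)"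
  using to_Der_in by (fastforce simp: derivations_def PiE_def)

lemma to_Der_add: "\<lbrakk>u \<in> carrier M; v \<in> carrier M\<rbrakk> \<Longrightarrow>
    to_Der M (u \<oplus>\<^bsub>M\<^esub> v) = to_Der M u \<oplus>\<^bsub>Der k A\<^esub> to_Der M v"
  using to_Der_hom by (auto simp: P_lie_hom_def P_hom_def mod_hom_def)

lemma to_Der_smult: "\<lbrakk>a \<in> carrier A; u \<in> carrier M\<rbrakk> \<Longrightarrow>
    to_Der M (a \<odot>\<^bsub>M\<^esub> u) = a \<odot>\<^bsub>Der k A\<^esub> to_Der M u"
  using to_Der_hom by (auto simp: P_lie_hom_def P_hom_def mod_hom_def)

text \<open>The anchor is A-linear and kills D, so it is constant on cosets of \<open>A D\<close>.
  Extensionality of \<open>to_Der M u\<close> enters because sums in \<open>Der\<close> are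
  restricted to \<open>carrier A\<close>.\<close>

lemma to_Der_cent_multiple_add:
  assumes "a \<in> carrier A" "u \<in> carrier M"
  shows "to_Der M (a \<odot>\<^bsub>M\<^esub> cent M \<oplus>\<^bsub>M\<^esub> u) = to_Der M u"
  using assms to_Der_ext[OF assms(2)]
  by (simp add: to_Der_add to_Der_smult cent_closed to_Der_cent Der_def cong: restrict_cong)
     (auto simp: fun_eq_iff extensional_def)

lemma cent_coeff_closed [simp]: "u \<in> carrier M \<Longrightarrow> cent_coeff u \<in> carrier A"
  using to_D1_hom
  by (auto simp: P_lie_hom_def P_hom_def mod_hom_def D1_def cent_coeff_def Pi_iff split: prod.splits)

lemma cent_coeff_add: "\<lbrakk>u \<in> carrier M; v \<in> carrier M\<rbrakk> \<Longrightarrow>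
    cent_coeff (u \<oplus>\<^bsub>M\<^esub> v) = cent_coeff u \<oplus>\<^bsub>A\<^esub> cent_coeff v"
  using to_D1_hom
  by (simp add: cent_coeff_def P_lie_hom_def P_hom_def mod_hom_def D1_def split_beta)

lemma cent_coeff_smult: "\<lbrakk>a \<in> carrier A; u \<in> carrier M\<rbrakk> \<Longrightarrow>
    cent_coeff (a \<odot>\<^bsub>M\<^esub> u) = a \<otimes>\<^bsub>A\<^esub> cent_coeff u"
  using to_D1_hom
  by (simp add: cent_coeff_def P_lie_hom_def P_hom_def mod_hom_def D1_def split_beta)

text \<open>The derivation term comes from the right action on \<open>D1\<close>; it becomes the
  term \<open>anchor L x c\<close> in the right action on \<open>L_ext\<close>.\<close>

lemma cent_coeff_ract: "\<lbrakk>u \<in> carrier M; a \<in> carrier A\<rbrakk> \<Longrightarrow>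
    cent_coeff (u \<oslash>\<^bsub>M\<^esub> a) = cent_coeff u \<otimes>\<^bsub>A\<^esub> a \<oplus>\<^bsub>A\<^esub> to_Der M u a"
  using to_D1_hom
  by (simp add: cent_coeff_def P_lie_hom_def P_hom_def D1_def split_beta to_Der_eq)

lemma cent_coeff_bracket: "\<lbrakk>u \<in> carrier M; v \<in> carrier M\<rbrakk> \<Longrightarrow>
    cent_coeff (bracket M u v) =
      (to_Der M u (cent_coeff v) \<ominus>\<^bsub>A\<^esub> to_Der M v (cent_coeff u)) \<oplus>\<^bsub>A\<^esub> f (to_Der M u) (to_Der M v)"
  using to_D1_hom
  by (simp add: cent_coeff_def P_lie_hom_def D1_def split_beta to_Der_eq)

text \<open>Solves \<open>d_act\<close> for the right action, which is thus determined by the left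
  action, the anchor and D.\<close>

lemma ract_eq:
  assumes "u \<in> carrier M" "a \<in> carrier A"
  shows "u \<oslash>\<^bsub>M\<^esub> a = to_Der M u a \<odot>\<^bsub>M\<^esub> cent M \<oplus>\<^bsub>M\<^esub> a \<odot>\<^bsub>M\<^esub> u"
  using assms ract_closed[of u a]
  by (simp add: d_act[symmetric] M.M.minus_eq M.M.a_assoc M.M.l_neg)

lemma horizontal_closed [simp]: "u \<in> carrier M \<Longrightarrow> horizontal u \<in> carrier M"
  by (simp add: horizontal_def cent_closed)

lemma horizontal_decomp:
  assumes "u \<in> carrier M"
  shows "cent_coeff u \<odot>\<^bsub>M\<^esub> cent M \<oplus>\<^bsub>M\<^esub> horizontal u = u"
  using assms cent_closed
  by (simp add: horizontal_def M.M.minus_eq M.M.a_lcomm[of _ u] M.M.r_neg)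

lemma horizontal_add:
  assumes [simp]: "u \<in> carrier M" "v \<in> carrier M"
  shows "horizontal (u \<oplus>\<^bsub>M\<^esub> v) = horizontal u \<oplus>\<^bsub>M\<^esub> horizontal v"
proof -
  have [simp]: "cent M \<in> carrier M" by (rule cent_closed)
  show ?thesis
    by (simp add: horizontal_def cent_coeff_add M.smult_l_distr M.M.minus_eq M.M.minus_add M.M.a_ac)
qed

lemma horizontal_smult:
  assumes [simp]: "a \<in> carrier A" "u \<in> carrier M"
  shows "horizontal (a \<odot>\<^bsub>M\<^esub> u) = a \<odot>\<^bsub>M\<^esub> horizontal u"
proof -
  have [simp]: "cent M \<in> carrier M" by (rule cent_closed)
  show ?thesis
    by (simp add: horizontal_def cent_coeff_smult M.smult_r_distr M.smult_assoc1 M.M.minus_eq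
        M.smult_r_minus)
qed

lemma to_Der_horizontal: "u \<in> carrier M \<Longrightarrow> to_Der M (horizontal u) = to_Der M u"
  using to_Der_cent_multiple_add[of "cent_coeff u" "horizontal u"] by (simp add: horizontal_decomp)

section \<open>The ideal \<open>A D\<close> and the operations of the canonical quotient\<close>

lemma cent_ideal_subgroup: "abelian_subgroup (cent_ideal A M) M"
proof (rule abelian_subgroupI3)
  have "subgroup (cent_ideal A M) (add_monoid M)"
  proof
    show "cent_ideal A M \<subseteq> carrier (add_monoid M)"
      by (auto simp: cent_ideal_def cent_closed)
    show "x \<otimes>\<^bsub>add_monoid M\<^esub> y \<in> cent_ideal A M"
      if xy: "x \<in> cent_ideal A M" "y \<in> cent_ideal A M" for x y
    proof -
      obtain a b where "a \<in> carrier A" "b \<in> carrier A"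
        "x = a \<odot>\<^bsub>M\<^esub> cent M" "y = b \<odot>\<^bsub>M\<^esub> cent M"
        using xy by (auto simp: cent_ideal_def)
      then show ?thesis
        unfolding cent_ideal_def
        by (auto simp: M.smult_l_distr cent_closed intro!: exI[of _ "a \<oplus>\<^bsub>A\<^esub> b"])
    qed
    show "\<one>\<^bsub>add_monoid M\<^esub> \<in> cent_ideal A M"
      using M.smult_l_null[OF cent_closed] by (force simp: cent_ideal_def)
    show "inv\<^bsub>add_monoid M\<^esub> x \<in> cent_ideal A M" if x: "x \<in> cent_ideal A M" for x
    proof -
      obtain a where "a \<in> carrier A" "x = a \<odot>\<^bsub>M\<^esub> cent M"
        using x by (auto simp: cent_ideal_def)
      then show ?thesis
        unfolding cent_ideal_def a_inv_def[symmetric]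
        by (auto simp: M.smult_l_minus cent_closed intro!: exI[of _ "\<ominus>\<^bsub>A\<^esub> a"])
    qed
  qed
  then show "additive_subgroup (cent_ideal A M) M"
    by (rule additive_subgroup.intro)
  show "abelian_group M" ..
qed

sublocale J: abelian_subgroup "cent_ideal A M" M
  by (rule cent_ideal_subgroup)

lemma mem_coset_iff: "v \<in> coset u \<longleftrightarrow> (\<exists>a\<in>carrier A. v = a \<odot>\<^bsub>M\<^esub> cent M \<oplus>\<^bsub>M\<^esub> u)"
  by (auto simp: a_r_coset_def' cent_ideal_def)

lemma coset_cent_multiple_add:
  assumes "a \<in> carrier A" "u \<in> carrier M"
  shows "coset (a \<odot>\<^bsub>M\<^esub> cent M \<oplus>\<^bsub>M\<^esub> u) = coset u"
  using M.M.a_repr_independence[of "a \<odot>\<^bsub>M\<^esub> cent M \<oplus>\<^bsub>M\<^esub> u" "cent_ideal A M" u] assms J.a_subgroup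
  by (auto simp: mem_coset_iff)

lemma coset_self: "u \<in> carrier M \<Longrightarrow> u \<in> coset u"
  by (rule J.a_rcos_self)

lemma carrier_L: "carrier L = coset ` carrier M"
  by (auto simp: canonical_quotient_def Let_def A_RCOSETS_def')

lemma add_L: "\<lbrakk>u \<in> carrier M; v \<in> carrier M\<rbrakk> \<Longrightarrow> coset u \<oplus>\<^bsub>L\<^esub> coset v = coset (u \<oplus>\<^bsub>M\<^esub> v)"
  by (simp add: canonical_quotient_def Let_def J.a_rcos_sum)

text \<open>Two representatives differ by some \<open>b D\<close>, so their multiples by
  \<open>a\<close> differ by a multiple of D again: all members of the union defining the operation
  are the same coset.\<close>

lemma smult_L:
  assumes "a \<in> carrier A" "u \<in> carrier M"
  shows "a \<odot>\<^bsub>L\<^esub> coset u = coset (a \<odot>\<^bsub>M\<^esub> u)"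
proof -
  have "coset (a \<odot>\<^bsub>M\<^esub> v) = coset (a \<odot>\<^bsub>M\<^esub> u)" if "v \<in> coset u" for v
  proof -
    obtain b where b: "b \<in> carrier A" "v = b \<odot>\<^bsub>M\<^esub> cent M \<oplus>\<^bsub>M\<^esub> u"
      using \<open>v \<in> coset u\<close> mem_coset_iff by blast
    then have "a \<odot>\<^bsub>M\<^esub> v = (a \<otimes>\<^bsub>A\<^esub> b) \<odot>\<^bsub>M\<^esub> cent M \<oplus>\<^bsub>M\<^esub> a \<odot>\<^bsub>M\<^esub> u"
      using assms by (simp add: M.smult_r_distr M.smult_assoc1 cent_closed)
    then show ?thesis using assms b by (simp add: coset_cent_multiple_add)
  qed
  then have "(\<Union>v\<in>coset u. coset (a \<odot>\<^bsub>M\<^esub> v)) = coset (a \<odot>\<^bsub>M\<^esub> u)"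
    by (intro UN_constant_eq[OF coset_self[OF assms(2)]] ballI)
  then show ?thesis
    by (simp add: canonical_quotient_def Let_def)
qed

lemma bracket_anticomm:
  assumes [simp]: "u \<in> carrier M" "v \<in> carrier M"
  shows "bracket M u v = \<ominus>\<^bsub>M\<^esub> bracket M v u"
proof -
  have [simp]: "bracket M u v \<in> carrier M" "bracket M v u \<in> carrier M"
    by (simp_all add: br_closed)
  \<comment> \<open>Polarisation: expanding the alternating law at a sum leaves only the two mixed
    brackets.\<close>
  have "\<zero>\<^bsub>M\<^esub> = bracket M (u \<oplus>\<^bsub>M\<^esub> v) (u \<oplus>\<^bsub>M\<^esub> v)" by (simp add: br_alt)
  also have "\<dots> = bracket M u v \<oplus>\<^bsub>M\<^esub> bracket M v u"
    by (simp add: br_add_l br_add_r br_alt[of u] br_alt[of v] M.M.a_comm)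
  finally show ?thesis by (intro M.M.minus_equality[symmetric]) simp_all
qed

text \<open>Centrality of D removes one of the two Leibniz terms. Since the other is a multiple of
  D, \<open>A D\<close> is an ideal for the bracket.\<close>

lemma bracket_cent_multiple:
  assumes [simp]: "u \<in> carrier M" "a \<in> carrier A"
  shows "bracket M u (a \<odot>\<^bsub>M\<^esub> cent M) = to_Der M u a \<odot>\<^bsub>M\<^esub> cent M"
proof -
  have [simp]: "cent M \<in> carrier M" by (rule cent_closed)
  have "bracket M u (cent M) = \<zero>\<^bsub>M\<^esub>"
    using bracket_anticomm[of u "cent M"] by (simp add: cent_central)
  then show ?thesis by (simp add: leibniz)
qed

lemma coset_bracket_cong_r:
  assumes "u \<in> carrier M" "v \<in> carrier M" "w \<in> coset v"
  shows "coset (bracket M u w) = coset (bracket M u v)"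
proof -
  obtain b where b: "b \<in> carrier A" "w = b \<odot>\<^bsub>M\<^esub> cent M \<oplus>\<^bsub>M\<^esub> v"
    using assms mem_coset_iff by blast
  then have "bracket M u w = to_Der M u b \<odot>\<^bsub>M\<^esub> cent M \<oplus>\<^bsub>M\<^esub> bracket M u v"
    using assms by (simp add: br_add_r cent_closed bracket_cent_multiple)
  then show ?thesis using assms b by (simp add: coset_cent_multiple_add br_closed)
qed

lemma coset_bracket_cong_l:
  assumes "u \<in> carrier M" "v \<in> carrier M" "w \<in> coset u"
  shows "coset (bracket M w v) = coset (bracket M u v)"
proof -
  obtain b where b: "b \<in> carrier A" "w = b \<odot>\<^bsub>M\<^esub> cent M \<oplus>\<^bsub>M\<^esub> u"
    using assms mem_coset_iff by blast
  \<comment> \<open>The Leibniz rule concerns the second argument only, so the arguments are swapped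
    at the cost of a sign.\<close>
  have "bracket M (b \<odot>\<^bsub>M\<^esub> cent M) v = (\<ominus>\<^bsub>A\<^esub> to_Der M v b) \<odot>\<^bsub>M\<^esub> cent M"
    using assms b bracket_anticomm[of "b \<odot>\<^bsub>M\<^esub> cent M" v]
    by (simp add: bracket_cent_multiple cent_closed M.smult_l_minus)
  then have "bracket M w v = (\<ominus>\<^bsub>A\<^esub> to_Der M v b) \<odot>\<^bsub>M\<^esub> cent M \<oplus>\<^bsub>M\<^esub> bracket M u v"
    using assms b by (simp add: br_add_l cent_closed)
  then show ?thesis using assms b by (simp add: coset_cent_multiple_add br_closed)
qed

text \<open>Because \<open>A D\<close> is an ideal on both sides, the two representatives can be
  replaced one at a time, and the double union collapses to one coset.\<close>

lemma bracket_L: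
  assumes "u \<in> carrier M" "v \<in> carrier M"
  shows "lr_bracket L (coset u) (coset v) = coset (bracket M u v)"
proof -
  have "(\<Union>v'\<in>coset v. coset (bracket M u' v')) = coset (bracket M u v)" if "u' \<in> coset u" for u'
  proof (intro UN_constant_eq[OF coset_self[OF assms(2)]] ballI)
    fix v' assume "v' \<in> coset v"
    moreover have "u' \<in> carrier M"
      using that assms by (auto simp: mem_coset_iff cent_closed)
    ultimately have "coset (bracket M u' v') = coset (bracket M u' v)"
      using assms by (intro coset_bracket_cong_r)
    also have "\<dots> = coset (bracket M u v)"
      using that assms by (intro coset_bracket_cong_l)
    finally show "coset (bracket M u' v') = coset (bracket M u v)" .
  qed
  then have "(\<Union>u'\<in>coset u. \<Union>v'\<in>coset v. coset (bracket M u' v')) = coset (bracket M u v)"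
    by (intro UN_constant_eq[OF coset_self[OF assms(1)]] ballI)
  then show ?thesis
    by (simp add: canonical_quotient_def Let_def)
qed

lemma anchor_L:
  assumes "u \<in> carrier M"
  shows "anchor L (coset u) = to_Der M u"
proof -
  have "the_elem (to_Der M ` coset u) = to_Der M u"
  proof (rule the_elem_image_unique)
    show "coset u \<noteq> {}" using coset_self[OF assms] by blast
  qed (use assms in \<open>auto simp: mem_coset_iff to_Der_cent_multiple_add\<close>)
  then show ?thesis by (simp add: canonical_quotient_def Let_def)
qed

lemma coset_horizontal: "u \<in> carrier M \<Longrightarrow> coset (horizontal u) = coset u"
  using coset_cent_multiple_add[of "cent_coeff u" "horizontal u"] by (simp add: horizontal_decomp)

lemma coset_cent: "coset (cent M) = \<zero>\<^bsub>L\<^esub>"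
proof -
  have "coset (cent M) = coset \<zero>\<^bsub>M\<^esub>"
    using coset_cent_multiple_add[of "\<one>\<^bsub>A\<^esub>" "\<zero>\<^bsub>M\<^esub>"] by (simp add: cent_closed)
  then show ?thesis
    using J.a_subset by (simp add: canonical_quotient_def Let_def)
qed

text \<open>Every element of \<open>N\<close> has the form \<open>h u\<close>, so each law for
  \<open>h'\<close> is the corresponding law for \<open>h\<close> read backwards. \<open>N\<close>
  enters only as a record; all closure properties come from \<open>M\<close>.\<close>

lemma dlie_iso_inverse:
  fixes N :: "('a, 'n, 'v) dlie_scheme"
  assumes h: "h \<in> dlie_hom A M N" "bij_betw h (carrier M) (carrier N)"
    and inv: "\<And>u. u \<in> carrier M \<Longrightarrow> h' (h u) = u"
  shows "h' \<in> dlie_iso A N M"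
proof -
  have carr: "carrier N = h ` carrier M"
    using h by (auto simp: bij_betw_def)
  have "bij_betw h' (carrier N) (carrier M)"
    using inv by (intro bij_betw_byWitness[where f' = h]) (auto simp: carr)
  \<comment> \<open>The laws are oriented so that every expression in \<open>N\<close> becomes an
    image under \<open>h\<close>, where \<open>h'\<close> cancels.\<close>
  moreover have
     "\<And>u v. u \<in> carrier M \<Longrightarrow> v \<in> carrier M \<Longrightarrow> h u \<oplus>\<^bsub>N\<^esub> h v = h (u \<oplus>\<^bsub>M\<^esub> v)"
     "\<And>u v. u \<in> carrier M \<Longrightarrow> v \<in> carrier M \<Longrightarrow> bracket N (h u) (h v) = h (bracket M u v)"
     "\<And>a u. a \<in> carrier A \<Longrightarrow> u \<in> carrier M \<Longrightarrow> a \<odot>\<^bsub>N\<^esub> h u = h (a \<odot>\<^bsub>M\<^esub> u)"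
     "\<And>a u. a \<in> carrier A \<Longrightarrow> u \<in> carrier M \<Longrightarrow> h u \<oslash>\<^bsub>N\<^esub> a = h (u \<oslash>\<^bsub>M\<^esub> a)"
     "\<And>u. u \<in> carrier M \<Longrightarrow> to_Der N (h u) = to_Der M u" "cent N = h (cent M)"
    using h by (simp_all add: dlie_hom_def P_lie_hom_def P_hom_def mod_hom_def)
  ultimately show ?thesis
    by (auto simp: dlie_iso_def dlie_hom_def P_lie_hom_def P_hom_def mod_hom_def carr inv
        br_closed ract_closed cent_closed)
qed

section \<open>Connections over a D-Lie algebra\<close>

context
  fixes E :: "('a, 'e, 'u) module_scheme" and \<rho> :: "'l \<Rightarrow> 'e \<Rightarrow> 'e"
  assumes conn: "dlie_connection k A M E \<rho>"
begin

interpretation E: module A E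
  using conn by (simp add: dlie_connection_def)

text \<open>\<open>Diff1\<close> shrinks the carrier of \<open>End_k\<close> and keeps its
  operations, so connections can be computed with in \<open>End_k\<close>.\<close>

lemma connection_closed: "u \<in> carrier M \<Longrightarrow> \<rho> u \<in> carrier (End_k k A E)"
  using conn by (auto simp: dlie_connection_def P_hom_def mod_hom_def Diff1_def)

lemma connection_add: "\<lbrakk>u \<in> carrier M; v \<in> carrier M\<rbrakk> \<Longrightarrow>
    \<rho> (u \<oplus>\<^bsub>M\<^esub> v) = \<rho> u \<oplus>\<^bsub>End_k k A E\<^esub> \<rho> v"
  using conn by (auto simp: dlie_connection_def P_hom_def mod_hom_def Diff1_def)

lemma connection_smult: "\<lbrakk>a \<in> carrier A; u \<in> carrier M\<rbrakk> \<Longrightarrow>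
    \<rho> (a \<odot>\<^bsub>M\<^esub> u) = a \<odot>\<^bsub>End_k k A E\<^esub> \<rho> u"
  using conn by (auto simp: dlie_connection_def P_hom_def mod_hom_def Diff1_def)

lemma connection_ract: "\<lbrakk>u \<in> carrier M; a \<in> carrier A\<rbrakk> \<Longrightarrow>
    \<rho> (u \<oslash>\<^bsub>M\<^esub> a) = \<rho> u \<oslash>\<^bsub>End_k k A E\<^esub> a"
  using conn by (auto simp: dlie_connection_def P_hom_def mod_hom_def Diff1_def)

lemma connection_value_closed: "\<lbrakk>u \<in> carrier M; e \<in> carrier E\<rbrakk> \<Longrightarrow> \<rho> u e \<in> carrier E"
  using connection_closed by (fastforce simp: End_k_def)

lemma connection_leibniz:
  assumes "u \<in> carrier M" "a \<in> carrier A" "e \<in> carrier E"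
  shows "\<rho> u (a \<odot>\<^bsub>E\<^esub> e) = a \<odot>\<^bsub>E\<^esub> \<rho> u e \<oplus>\<^bsub>E\<^esub> to_Der M u a \<odot>\<^bsub>E\<^esub> \<rho> (cent M) e"
proof -
  \<comment> \<open>The right action on operators is precomposition with multiplication by the
    scalar.\<close>
  have "\<rho> u (a \<odot>\<^bsub>E\<^esub> e) = \<rho> (u \<oslash>\<^bsub>M\<^esub> a) e"
    using assms by (simp add: connection_ract) (simp add: End_k_def)
  also have "\<dots> = to_Der M u a \<odot>\<^bsub>E\<^esub> \<rho> (cent M) e \<oplus>\<^bsub>E\<^esub> a \<odot>\<^bsub>E\<^esub> \<rho> u e"
    using assms by (simp add: ract_eq connection_add connection_smult cent_closed) (simp add: End_k_def)
  finally show ?thesis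
    using assms by (simp add: E.M.a_comm connection_value_closed cent_closed)
qed

text \<open>D has zero anchor, so the correction term in the Leibniz rule for
  \<open>\<rho> (cent M)\<close> vanishes. This operator will serve as
  \<open>\<psi>\<close>.\<close>

lemma connection_cent: "\<rho> (cent M) \<in> End_A A E"
proof -
  have "\<rho> (cent M) (a \<odot>\<^bsub>E\<^esub> e) = a \<odot>\<^bsub>E\<^esub> \<rho> (cent M) e" if "a \<in> carrier A" "e \<in> carrier E" for a e
    using that connection_leibniz[OF cent_closed that]
    by (simp add: to_Der_cent Der_def connection_value_closed cent_closed)
  then show ?thesis
    using connection_closed[OF cent_closed] by (auto simp: End_A_def mod_hom_def End_k_def PiE_def)
qed

end

end

section \<open>The splitting when D maps to the central element \<open>(1, 0)\<close> of
  \<open>D1\<close>\<close>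

locale unital_dlie_algebra = dlie_algebra k A f M
  for k :: "('k, 'r) ring_scheme" and A :: "('k, 'a, 's) module_scheme"
    and f :: "('a \<Rightarrow> 'a) \<Rightarrow> ('a \<Rightarrow> 'a) \<Rightarrow> 'a" and M :: "('a, 'l, 't) dlie_scheme" +
  assumes to_D1_cent: "to_D1 M (cent M) = (\<one>\<^bsub>A\<^esub>, \<zero>\<^bsub>Der k A\<^esub>)"
begin

text \<open>The section \<open>s\<close> of the overview. \<open>the_elem\<close> is meaningful
  because \<open>horizontal\<close> takes a single value on each coset, as
  \<open>horizontal_cent_multiple_add\<close> shows.\<close>

definition sec :: "'l set \<Rightarrow> 'l" where
  "sec X = the_elem (horizontal ` X)"

definition splitting :: "'a \<times> 'l set \<Rightarrow> 'l" where
  "splitting = (\<lambda>(a, X). a \<odot>\<^bsub>M\<^esub> cent M \<oplus>\<^bsub>M\<^esub> sec X)"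

definition unsplit :: "'l \<Rightarrow> 'a \<times> 'l set" where
  "unsplit u = (cent_coeff u, coset u)"

text \<open>The normalisation of D enters here: with it \<open>cent_coeff (a D) = a\<close>, so
  \<open>A D\<close> is free of rank one and \<open>cent_coeff\<close> retracts onto it.\<close>

lemma cent_coeff_cent [simp]: "cent_coeff (cent M) = \<one>\<^bsub>A\<^esub>"
  by (simp add: cent_coeff_def to_D1_cent)

lemma horizontal_cent_multiple_add:
  assumes "a \<in> carrier A" "u \<in> carrier M"
  shows "horizontal (a \<odot>\<^bsub>M\<^esub> cent M \<oplus>\<^bsub>M\<^esub> u) = horizontal u"
proof -
  have "horizontal (a \<odot>\<^bsub>M\<^esub> cent M) = \<zero>\<^bsub>M\<^esub>"
    using assms cent_closed by (simp add: horizontal_def cent_coeff_smult M.M.minus_eq M.M.r_neg)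
  then show ?thesis using assms cent_closed by (simp add: horizontal_add)
qed

text \<open>With \<open>c\<close> the coefficient of \<open>u\<close>, the coefficient of
  \<open>u - c D\<close> is \<open>c - c\<close>. Hence \<open>cent_coeff\<close> recovers
  \<open>a\<close> from \<open>a D + s(x)\<close>.\<close>

lemma cent_coeff_horizontal:
  assumes "u \<in> carrier M"
  shows "cent_coeff (horizontal u) = \<zero>\<^bsub>A\<^esub>"
  using assms cent_closed
  by (simp add: horizontal_def M.M.minus_eq cent_coeff_add cent_coeff_smult r_neg
      flip: M.smult_l_minus)

lemma sec_coset:
  assumes "u \<in> carrier M"
  shows "sec (coset u) = horizontal u"
  unfolding sec_def
proof (rule the_elem_image_unique)
  show "coset u \<noteq> {}" using coset_self[OF assms] by blast
qed (use assms in \<open>auto simp: mem_coset_iff horizontal_cent_multiple_add\<close>)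

lemma splitting_unsplit: "u \<in> carrier M \<Longrightarrow> splitting (unsplit u) = u"
  by (simp add: splitting_def unsplit_def sec_coset horizontal_decomp)

lemma bij_betw_unsplit: "bij_betw unsplit (carrier M) (carrier (L_ext A L f))"
proof (rule bij_betw_byWitness[where f' = splitting])
  \<comment> \<open>Elements of the quotient are cosets, so it suffices to treat a representative
    \<open>u\<close>: the coefficient of \<open>a D + horizontal u\<close> is \<open>a\<close>, and
    its coset is that of \<open>u\<close>.\<close>
  have *: "unsplit (splitting (a, coset u)) = (a, coset u) \<and> splitting (a, coset u) \<in> carrier M"
    if "a \<in> carrier A" "u \<in> carrier M" for a u
    using that by (simp add: unsplit_def splitting_def sec_coset cent_closed cent_coeff_add
        cent_coeff_smult cent_coeff_horizontal coset_cent_multiple_add coset_horizontal)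
  show "\<forall>p\<in>carrier (L_ext A L f). unsplit (splitting p) = p"
    and "splitting ` carrier (L_ext A L f) \<subseteq> carrier M"
    using * by (auto simp: L_ext_def carrier_L)
  show "unsplit ` carrier M \<subseteq> carrier (L_ext A L f)"
    by (auto simp: L_ext_def carrier_L unsplit_def)
qed (simp add: splitting_unsplit)

text \<open>Each operation of \<open>L_ext\<close> pairs a formula for \<open>cent_coeff\<close>
  with one for cosets. The bracket matches for the given \<open>f\<close> because the anchor of
  \<open>coset u\<close> is \<open>to_Der M u\<close>, so the pullback of \<open>f\<close> is
  exactly the cocycle term in \<open>cent_coeff_bracket\<close>.\<close>

lemma unsplit_dlie_hom: "unsplit \<in> dlie_hom A M (L_ext A L f)"
proof -
  \<comment> \<open>Left and right actions differ by a multiple of D, hence agree on the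
    quotient.\<close>
  have "coset (u \<oslash>\<^bsub>M\<^esub> a) = a \<odot>\<^bsub>L\<^esub> coset u" if "u \<in> carrier M" "a \<in> carrier A" for u a
    using that by (simp add: ract_eq coset_cent_multiple_add smult_L)
  then show ?thesis
    by (auto simp: dlie_hom_def P_lie_hom_def P_hom_def mod_hom_def unsplit_def L_ext_def carrier_L
        cent_coeff_add cent_coeff_smult cent_coeff_ract cent_coeff_bracket add_L smult_L bracket_L
        anchor_L pullback_def coset_cent)
qed

lemma splitting_dlie_iso: "splitting \<in> dlie_iso A (L_ext A L f) M"
  using unsplit_dlie_hom bij_betw_unsplit splitting_unsplit by (rule dlie_iso_inverse)

text \<open>Linearity is inherited from \<open>horizontal\<close>. Horizontal parts keep their
  anchor, so the Leibniz rule for \<open>\<rho>\<close> restricts to the required rule with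
  \<open>\<psi> = \<rho> (cent M)\<close>.\<close>

lemma psi_connection_sec:
  assumes "dlie_connection k A M E \<rho>"
  shows "psi_connection k A L E (\<rho> (cent M)) (\<rho> \<circ> sec)"
  by (auto simp: psi_connection_def mod_hom_def carrier_L sec_coset add_L smult_L anchor_L
      assms[THEN connection_closed] assms[THEN connection_add] assms[THEN connection_smult]
      assms[THEN connection_leibniz]
      horizontal_add horizontal_smult to_Der_horizontal)

lemma connection_splitting:
  assumes "dlie_connection k A M E \<rho>" "a \<in> carrier A" "X \<in> carrier L"
  shows "\<rho> (splitting (a, X)) = C_conn k A E (\<rho> (cent M)) (\<rho> \<circ> sec) (a, X)"
  using assms
  by (auto simp: splitting_def C_conn_def carrier_L sec_coset connection_add connection_smult cent_closed)

end

theorem corollary1p5: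
  fixes k :: "('k, 'r) ring_scheme" and A :: "('k, 'a, 's) module_scheme"
    and g :: "('a \<Rightarrow> 'a) \<Rightarrow> ('a \<Rightarrow> 'a) \<Rightarrow> 'a"
    and Lt :: "('a, 'l, 't) dlie_scheme"
    and E :: "('a, 'e, 'u) module_scheme" and \<rho> :: "'l \<Rightarrow> 'e \<Rightarrow> 'e"
  assumes "dlie_algebra k A g Lt"
    and unit: "to_D1 Lt (cent Lt) = (\<one>\<^bsub>A\<^esub>, \<zero>\<^bsub>Der k A\<^esub>)"
    and "dlie_connection k A Lt E \<rho>"
    and "projective_module A (canonical_quotient A Lt)"
  shows "(\<exists>f \<tau> \<psi> nabla. f \<in> cocycles2 A (Der_LR k A) \<and>
            \<tau> \<in> dlie_iso A (L_ext A (canonical_quotient A Lt) f) Lt \<and>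
            \<psi> \<in> End_A A E \<and>
            psi_connection k A (canonical_quotient A Lt) E \<psi> nabla \<and>
            (\<forall>a\<in>carrier A. \<forall>x\<in>carrier (canonical_quotient A Lt).
               \<rho> (\<tau> (a, x)) = C_conn k A E \<psi> nabla (a, x))) \<and>
         (\<rho> (cent Lt) = id_on E \<longrightarrow>
          (\<exists>f \<tau> nabla. f \<in> cocycles2 A (Der_LR k A) \<and>
            \<tau> \<in> dlie_iso A (L_ext A (canonical_quotient A Lt) f) Lt \<and>
            L_connection k A (canonical_quotient A Lt) E nabla \<and>
            (\<forall>a\<in>carrier A. \<forall>x\<in>carrier (canonical_quotient A Lt).
               \<rho> (\<tau> (a, x)) = C_conn k A E (id_on E) nabla (a, x))))"
proof -
  interpret unital_dlie_algebra k A g Lt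
    using assms(1) unit by (simp add: unital_dlie_algebra_def unital_dlie_algebra_axioms_def)
  show ?thesis
    \<comment> \<open>The witnesses are \<open>f = g\<close>, \<open>\<tau> = splitting\<close>,
      \<open>\<psi> = \<rho> (cent Lt)\<close> and \<open>nabla = \<rho> \<circ> sec\<close>. The
      same ones give the second claim after rewriting \<open>\<psi>\<close> to
      \<open>id_on E\<close>.\<close>
    unfolding L_connection_def
    using cocycle splitting_dlie_iso connection_cent[OF assms(3)] psi_connection_sec[OF assms(3)]
      connection_splitting[OF assms(3)]
    by metis
qed

end
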